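(* Let $n$ and $a$ be positive integers with $a < n$ and $\gcd(a, 2n) = 1$, and let $G$ be a graph isomorphic to the circulant graph $C(2n; a, n)$ (a $3$-regular connected graph). Then $\mathcal{R}(G) \le 3$.
   Context: All graphs are simple and undirected. For a positive integer $N$ and integers $0 < a_1 < a_2 < \cdots < a_k < (N+1)/2$, the circulant graph $C(N; a_1, \ldots, a_k)$ has vertex set $\{0, 1, \ldots, N-1\}$, and two distinct vertices $i, j$ are adjacent if and only if $(i-j) \bmod N$ or $(j-i) \bmod N$ belongs to $\{a_1, \ldots, a_k\}$. Two distinct letters $x, y$ alternate in a word $w$ if, after deleting from $w$ all letters other than $x$ and $y$, one obtains a word $xyxy\cdots$ or $yxyx\cdots$ (of odd or even length). A word $w$ over the alphabet $V$, containing each letter of $V$ at least once, represents a graph $G=(V,E)$ if for all distinct $x,y \in V$: $xy \in E$ if and only if $x$ and $y$ alternate in $w$. A word is $r$-uniform if each letter occurs in it exactly $r$ times. A graph is $r$-word-representable if it is represented by some $r$-uniform word. The representation number $\mathcal{R}(G)$ of a word-representable graph $G$ is the least $r \ge 1$ such that $G$ is $r$-word-representable; in particular, the inequality $\mathcal{R}(G) \le 3$ includes the assertion that $G$ is word-representable. *)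

theory Defs
  imports
    "Graph_Theory.Pair_Digraph"
    "Graph_Theory.Digraph_Isomorphism"
    "HOL-Library.Extended_Nat"
begin

text \<open>
  A simple undirected graph is an instance of the locale \<^locale>\<open>graph\<close>: a finite, loop-free,
  symmetric digraph without parallel arcs.  Adjacency of two vertices is \<^const>\<open>dominates\<close>.
\<close>

text \<open>
  The circulant graph $C(N; a_1, \ldots, a_k)$, for $N > 0$ and a set
  $S = \{a_1, \ldots, a_k\}$ of integers with $0 < a_i < (N + 1)/2$.
\<close>

definition circulant :: "int \<Rightarrow> int set \<Rightarrow> int pair_pre_digraph" where
  "circulant N S = \<lparr> pverts = {0..<N},
     parcs = {(i, j). i \<in> {0..<N} \<and> j \<in> {0..<N} \<and> i \<noteq> j \<and>
                ((i - j) mod N \<in> S \<or> (j - i) mod N \<in> S)} \<rparr>"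

lemma pair_graph_circulant: "pair_graph (circulant N S)"
proof
  show "finite (parcs (circulant N S))"
    by (rule finite_subset[of _ "{0..<N} \<times> {0..<N}"]) (auto simp: circulant_def)
qed (auto simp: circulant_def symmetric_def sym_def)

text \<open>The word $xyxy\cdots$ of length \<open>m\<close>.\<close>

primrec alternating_word :: "'v \<Rightarrow> 'v \<Rightarrow> nat \<Rightarrow> 'v list" where
  "alternating_word x y 0 = []"
| "alternating_word x y (Suc m) = x # alternating_word y x m"

definition alternate :: "'v \<Rightarrow> 'v \<Rightarrow> 'v list \<Rightarrow> bool" where
  "alternate x y w \<longleftrightarrow>
     (\<exists>m. filter (\<lambda>z. z = x \<or> z = y) w = alternating_word x y m \<or>
          filter (\<lambda>z. z = x \<or> z = y) w = alternating_word y x m)"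

definition represents :: "'v list \<Rightarrow> ('v, 'e) pre_digraph \<Rightarrow> bool" where
  "represents w G \<longleftrightarrow> set w = verts G \<and>
     (\<forall>x \<in> verts G. \<forall>y \<in> verts G. x \<noteq> y \<longrightarrow> (x \<rightarrow>\<^bsub>G\<^esub> y \<longleftrightarrow> alternate x y w))"

definition word_representable :: "('v, 'e) pre_digraph \<Rightarrow> bool" where
  "word_representable G \<longleftrightarrow> (\<exists>w. represents w G)"

definition uniform_word :: "nat \<Rightarrow> 'v set \<Rightarrow> 'v list \<Rightarrow> bool" where
  "uniform_word r V w \<longleftrightarrow> (\<forall>x \<in> V. count_list w x = r)"

definition r_word_representable :: "nat \<Rightarrow> ('v, 'e) pre_digraph \<Rightarrow> bool" where
  "r_word_representable r G \<longleftrightarrow> (\<exists>w. uniform_word r (verts G) w \<and> represents w G)"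

text \<open>
  The infimum is taken in \<^typ>\<open>enat\<close>: it is the least such \<open>r\<close> if there is one, and \<open>\<infinity>\<close>
  otherwise, so that a finite bound entails representability.
\<close>

definition representation_number :: "('v, 'e) pre_digraph \<Rightarrow> enat" where
  "representation_number G = (INF r \<in> {r. 1 \<le> r \<and> r_word_representable r G}. enat r)"

end

theory Submission
  imports Defs "HOL-Number_Theory.Cong"
begin

text \<open>
  Since \<open>a\<close> is a unit modulo \<open>2n\<close>, multiplication by \<open>a\<close> permutes the residues modulo \<open>2n\<close>; it
  turns differences \<open>\<plusminus>1\<close> into \<open>\<plusminus>a\<close> and, \<open>a\<close> being odd, fixes the difference \<open>n\<close>.  Hence
  $C(2n; a, n)$ is isomorphic to $C(2n; 1, n)$, the Moebius ladder: a cycle of length \<open>2n\<close> together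
  with its long diagonals (\<open>circulant_mult_adjacent_iff\<close>).

  The Moebius ladder is represented by the 3-uniform word that is the concatenation, for
  \<open>j = 0, \<dots>, 2n - 1\<close>, of the blocks \<open>j, j - 1, j + n\<close> (letters modulo \<open>2n\<close>).  To see why, write
  the word around a circle of \<open>6n\<close> points.  This does not affect alternation, because for letters
  that occur equally often alternation is invariant under cyclic shifts.  The letter \<open>x\<close> occupies
  the points \<open>3x\<close>, \<open>3x + 4\<close> and \<open>3x + 3n + 2\<close>, so the triangle of one letter is a rotation of the
  triangle of any other, and \<open>x\<close>, \<open>y\<close> alternate iff the triangle \<open>{0, 4, 3n + 2}\<close> interleaves
  with its rotation by \<open>s = 3(y - x)\<close>.  Interleaving requires the short arc from \<open>s\<close> to \<open>s + 4\<close> to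
  contain one of \<open>0\<close>, \<open>4\<close>, \<open>3n + 2\<close> in its interior, which for a nonzero multiple \<open>s\<close> of 3 leaves
  only \<open>s = -3\<close>, \<open>s = 3\<close> and \<open>s = 3n\<close>; and for these three rotations the triangles do interleave.

  The formal proof uses the linear word: \<open>sorted_positions_ladder_word\<close> lists the three positions
  of each letter in increasing order, \<open>alternate_iff_interleaved\<close> turns alternation into
  inequalities between positions, and \<open>alternate_ladder_word\<close> is then linear arithmetic.  Finally
  the word is carried over to the given graph along the bijection of vertices
  (\<open>represents_map\<close>, \<open>digraph_iso_inverse_map\<close>).
\<close>

section \<open>Alternation of letters that occur three times\<close>

lemma length_alternating_word [simp]: "length (alternating_word x y m) = m"
  by (induction m arbitrary: x y) auto

lemma alternating_word_6: "alternating_word x y 6 = [x, y, x, y, x, y]"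
  by (simp add: eval_nat_numeral)

lemma alternate_commute: "alternate x y w \<longleftrightarrow> alternate y x w"
  unfolding alternate_def by (subst disj_commute) (simp only: disj_commute)

lemma filter_conv_positions:
  "filter P w = map ((!) w) (filter (\<lambda>i. P (w ! i)) [0..<length w])"
  using filter_map[of P "(!) w" "[0..<length w]"] by (simp add: map_nth comp_def)

text \<open>
  The positions of \<open>x\<close> and \<open>y\<close> together form a strictly increasing list \<open>L\<close> of length 6.  Everything
  follows from the fact that such a list is determined by its set of elements.
\<close>

lemma filter_eq_alternating_word_iff:
  assumes x: "{i. i < length w \<and> w ! i = x} = {p1, p2, p3}" and p: "p1 < p2" "p2 < p3"
    and y: "{i. i < length w \<and> w ! i = y} = {q1, q2, q3}" and q: "q1 < q2" "q2 < q3"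
    and "x \<noteq> y"
  shows "(\<exists>m. filter (\<lambda>z. z = x \<or> z = y) w = alternating_word x y m) \<longleftrightarrow>
    p1 < q1 \<and> q1 < p2 \<and> p2 < q2 \<and> q2 < p3 \<and> p3 < q3"
proof -
  define L where "L = filter (\<lambda>i. w ! i = x \<or> w ! i = y) [0..<length w]"
  have w: "filter (\<lambda>z. z = x \<or> z = y) w = map ((!) w) L"
    unfolding L_def by (rule filter_conv_positions)
  have L: "sorted_wrt (<) L"
    unfolding L_def by (rule sorted_wrt_filter) simp
  have setL: "set L = {p1, p2, p3, q1, q2, q3}"
  proof -
    have "set L = {i. i < length w \<and> w ! i = x} \<union> {i. i < length w \<and> w ! i = y}"
      by (auto simp: L_def)
    then show ?thesis unfolding x y by auto
  qed
  have px: "w ! p1 = x" "w ! p2 = x" "w ! p3 = x" using x by blast+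
  have qy: "w ! q1 = y" "w ! q2 = y" "w ! q3 = y" using y by blast+
  have ne: "{p1, p2, p3} \<inter> {q1, q2, q3} = {}"
    unfolding x[symmetric] y[symmetric] using \<open>x \<noteq> y\<close> by auto
  have "length L = card (set L)"
    using L by (metis distinct_card strict_sorted_iff)
  also have "\<dots> = 6" unfolding setL using p q ne by auto
  finally have len: "length L = 6" .
  show ?thesis
  proof
    assume "\<exists>m. filter (\<lambda>z. z = x \<or> z = y) w = alternating_word x y m"
    then obtain m where m: "map ((!) w) L = alternating_word x y m"
      unfolding w by blast
    then have "m = 6" using len by (metis length_alternating_word length_map)
    obtain l1 l2 l3 l4 l5 l6 where l: "L = [l1, l2, l3, l4, l5, l6]"
      using len by (auto simp: eval_nat_numeral length_Suc_conv)
    with m have wl: "w ! l1 = x" "w ! l2 = y" "w ! l3 = x" "w ! l4 = y" "w ! l5 = x" "w ! l6 = y"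
      unfolding \<open>m = 6\<close> by (auto simp: alternating_word_6)
    have "{p1, p2, p3} = {i \<in> set L. w ! i = x}" unfolding x[symmetric] by (auto simp: L_def)
    also have "\<dots> = {l1, l3, l5}" using l wl \<open>x \<noteq> y\<close> by auto
    finally have P: "[p1, p2, p3] = [l1, l3, l5]"
      using p L l by (intro strict_sorted_equal) auto
    have "{q1, q2, q3} = {i \<in> set L. w ! i = y}" unfolding y[symmetric] by (auto simp: L_def)
    also have "\<dots> = {l2, l4, l6}" using l wl \<open>x \<noteq> y\<close> by auto
    finally have Q: "[q1, q2, q3] = [l2, l4, l6]"
      using q L l by (intro strict_sorted_equal) auto
    show "p1 < q1 \<and> q1 < p2 \<and> p2 < q2 \<and> q2 < p3 \<and> p3 < q3"
      using P Q L l by simp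
  next
    assume "p1 < q1 \<and> q1 < p2 \<and> p2 < q2 \<and> q2 < p3 \<and> p3 < q3"
    then have "L = [p1, q1, p2, q2, p3, q3]"
      using L setL by (intro strict_sorted_equal) auto
    then show "\<exists>m. filter (\<lambda>z. z = x \<or> z = y) w = alternating_word x y m"
      unfolding w using px qy by (intro exI[of _ 6]) (auto simp: alternating_word_6)
  qed
qed

lemma alternate_iff_interleaved:
  assumes x: "{i. i < length w \<and> w ! i = x} = {p1, p2, p3}" "p1 < p2" "p2 < p3"
    and y: "{i. i < length w \<and> w ! i = y} = {q1, q2, q3}" "q1 < q2" "q2 < q3"
    and "x \<noteq> y"
  shows "alternate x y w \<longleftrightarrow>
    p1 < q1 \<and> q1 < p2 \<and> p2 < q2 \<and> q2 < p3 \<and> p3 < q3 \<or>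
    q1 < p1 \<and> p1 < q2 \<and> q2 < p2 \<and> p2 < q3 \<and> q3 < p3"
proof -
  have "filter (\<lambda>z. z = x \<or> z = y) w = filter (\<lambda>z. z = y \<or> z = x) w"
    by (simp add: disj_commute)
  then show ?thesis
    unfolding alternate_def ex_disj_distrib
    using filter_eq_alternating_word_iff[OF x y \<open>x \<noteq> y\<close>]
      filter_eq_alternating_word_iff[OF y x \<open>x \<noteq> y\<close>[symmetric]] by simp
qed

section \<open>A word for the Moebius ladder\<close>

text \<open>
  Position \<open>p\<close> belongs to block \<open>j = p div 3\<close>, which reads \<open>j, j - 1, j + k\<close> modulo \<open>2 * k\<close>.  The
  reductions modulo \<open>2 * k\<close> are spelled out as case distinctions, which keeps all facts about
  positions within linear arithmetic.
\<close>

definition ladder_letter :: "nat \<Rightarrow> nat \<Rightarrow> nat" where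
  "ladder_letter k p =
     (let j = p div 3 in
      if p mod 3 = 0 then j
      else if p mod 3 = 1 then (if j = 0 then 2 * k - 1 else j - 1)
      else (if j < k then j + k else j - k))"

definition ladder_word :: "nat \<Rightarrow> nat list" where
  "ladder_word k = map (ladder_letter k) [0..<6 * k]"

text \<open>
  The three occurrences of \<open>x\<close> are at \<open>3 * x\<close>, \<open>3 * x + 4\<close> and \<open>3 * x + 3 * k + 2\<close> modulo \<open>6 * k\<close>:
  in the blocks \<open>x\<close>, \<open>x + 1\<close> and \<open>x + k\<close>, as their first, second and third letter respectively.
\<close>

lemma positions_ladder_word:
  assumes "x < 2 * k"
  shows "{i. i < length (ladder_word k) \<and> ladder_word k ! i = x} =
    {3 * x, if x = 2 * k - 1 then 1 else 3 * x + 4,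
     if x < k then 3 * x + 3 * k + 2 else 3 * x + 2 - 3 * k}" (is "?A = ?B")
proof -
  have A: "?A = {i. i < 6 * k \<and> ladder_letter k i = x}"
    by (auto simp: ladder_word_def)
  have "ladder_letter k i = x \<longleftrightarrow> i \<in> ?B" if "i < 6 * k" for i
  proof -
    define j r where "j = i div 3" and "r = i mod 3"
    have i: "i = 3 * j + r" "r < 3" by (auto simp: j_def r_def)
    have letter: "ladder_letter k i =
        (if r = 0 then j else if r = 1 then (if j = 0 then 2 * k - 1 else j - 1)
         else (if j < k then j + k else j - k))"
      unfolding ladder_letter_def j_def r_def by (simp add: Let_def)
    have "j < 2 * k" using that i by linarith
    consider "r = 0" | "r = 1" | "r = 2" using i by linarith
    then show ?thesis
    proof cases
      case 1
      then have "i = 3 * x \<longleftrightarrow> j = x" "i \<noteq> 3 * x + 4" "i \<noteq> 1" "i \<noteq> 3 * x + 3 * k + 2"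
        "x < k \<or> i \<noteq> 3 * x + 2 - 3 * k"
        using i by presburger+
      with 1 letter show ?thesis by auto
    next
      case 2
      then have "i = 3 * x + 4 \<longleftrightarrow> j = x + 1" "i = 1 \<longleftrightarrow> j = 0" "i \<noteq> 3 * x"
        "i \<noteq> 3 * x + 3 * k + 2" "x < k \<or> i \<noteq> 3 * x + 2 - 3 * k"
        using i by presburger+
      then have "i \<in> ?B \<longleftrightarrow> (if x = 2 * k - 1 then j = 0 else j = x + 1)" by auto
      also have "\<dots> \<longleftrightarrow> (if j = 0 then 2 * k - 1 else j - 1) = x"
        using assms \<open>j < 2 * k\<close> by (cases "j = 0"; cases "x = 2 * k - 1"; simp; linarith)
      finally show ?thesis using 2 letter by simp
    next
      case 3
      then have "i = 3 * x + 3 * k + 2 \<longleftrightarrow> j = x + k" "i \<noteq> 3 * x" "i \<noteq> 1" "i \<noteq> 3 * x + 4"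
        "x < k \<or> (i = 3 * x + 2 - 3 * k \<longleftrightarrow> j = x - k)"
        using i by presburger+
      then have "i \<in> ?B \<longleftrightarrow> (if x < k then j = x + k else j = x - k)" by auto
      also have "\<dots> \<longleftrightarrow> (if j < k then j + k else j - k) = x"
        using assms \<open>j < 2 * k\<close> by (cases "j < k"; cases "x < k"; simp; linarith)
      finally show ?thesis using 3 letter by simp
    qed
  qed
  moreover have "i < 6 * k" if "i \<in> ?B" for i
    using that assms by (auto split: if_splits)
  ultimately show ?thesis unfolding A by blast
qed

text \<open>
  Reduction modulo \<open>6 * k\<close> wraps none, one or two of the three positions around, which gives three
  possible orders.  The equations are additive because subtraction on \<^typ>\<open>nat\<close> truncates.
\<close>

lemma sorted_positions_ladder_word:
  assumes "x < 2 * k" "2 \<le> k"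
  obtains p1 p2 p3 where
    "{i. i < length (ladder_word k) \<and> ladder_word k ! i = x} = {p1, p2, p3}" "p1 < p2" "p2 < p3"
    "x < k \<and> p1 = 3 * x \<and> p2 = 3 * x + 4 \<and> p3 = 3 * x + 3 * k + 2 \<or>
     k \<le> x \<and> x + 1 < 2 * k \<and> p1 + 3 * k = 3 * x + 2 \<and> p2 = 3 * x \<and> p3 = 3 * x + 4 \<or>
     x + 1 = 2 * k \<and> p1 = 1 \<and> p2 + 1 = 3 * k \<and> p3 + 3 = 6 * k"
proof -
  consider "x < k" | "k \<le> x" "x < 2 * k - 1" | "x = 2 * k - 1"
    using assms by linarith
  then show ?thesis
  proof cases
    case 1
    with assms have "x \<noteq> 2 * k - 1" by linarith
    with 1 have "{i. i < length (ladder_word k) \<and> ladder_word k ! i = x} =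
        {3 * x, 3 * x + 4, 3 * x + 3 * k + 2}"
      using positions_ladder_word[OF assms(1)] by (simp only: if_True if_False)
    from that[OF this] 1 assms show ?thesis by simp
  next
    case 2
    then have "x \<noteq> 2 * k - 1" "\<not> x < k" by linarith+
    then have "{i. i < length (ladder_word k) \<and> ladder_word k ! i = x} =
        {3 * x, 3 * x + 4, 3 * x + 2 - 3 * k}"
      using positions_ladder_word[OF assms(1)] by (simp only: if_True if_False)
    also have "\<dots> = {3 * x + 2 - 3 * k, 3 * x, 3 * x + 4}" by blast
    finally show ?thesis
      using 2 assms by (intro that[of "3 * x + 2 - 3 * k" "3 * x" "3 * x + 4"]) (assumption | linarith)+
  next
    case 3
    with assms have *: "3 * x + 2 - 3 * k = 3 * k - 1" "3 * x = 6 * k - 3" "\<not> x < k"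
      by linarith+
    have "{i. i < length (ladder_word k) \<and> ladder_word k ! i = x} =
        {3 * x, 1, 3 * x + 2 - 3 * k}"
      using positions_ladder_word[OF assms(1)] unfolding if_P[OF 3] if_not_P[OF *(3)] .
    also have "\<dots> = {1, 3 * k - 1, 6 * k - 3}" unfolding *(1) unfolding *(2) by blast
    finally show ?thesis
      using 3 assms by (intro that[of "1" "3 * k - 1" "6 * k - 3"]) (assumption | linarith)+
  qed
qed

text \<open>
  The difference \<open>2 * k - 1\<close> is the edge between \<open>0\<close> and \<open>2 * k - 1\<close> that closes the cycle.
\<close>

lemma alternate_ladder_word:
  assumes "x < y" "y < 2 * k" "2 \<le> k"
  shows "alternate x y (ladder_word k) \<longleftrightarrow> y - x \<in> {1, k, 2 * k - 1}"
proof -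
  have "x < 2 * k" using assms by simp
  obtain p1 p2 p3 where p:
    "{i. i < length (ladder_word k) \<and> ladder_word k ! i = x} = {p1, p2, p3}" "p1 < p2" "p2 < p3"
    "x < k \<and> p1 = 3 * x \<and> p2 = 3 * x + 4 \<and> p3 = 3 * x + 3 * k + 2 \<or>
     k \<le> x \<and> x + 1 < 2 * k \<and> p1 + 3 * k = 3 * x + 2 \<and> p2 = 3 * x \<and> p3 = 3 * x + 4 \<or>
     x + 1 = 2 * k \<and> p1 = 1 \<and> p2 + 1 = 3 * k \<and> p3 + 3 = 6 * k"
    using sorted_positions_ladder_word[OF \<open>x < 2 * k\<close> \<open>2 \<le> k\<close>] .
  obtain q1 q2 q3 where q:
    "{i. i < length (ladder_word k) \<and> ladder_word k ! i = y} = {q1, q2, q3}" "q1 < q2" "q2 < q3"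
    "y < k \<and> q1 = 3 * y \<and> q2 = 3 * y + 4 \<and> q3 = 3 * y + 3 * k + 2 \<or>
     k \<le> y \<and> y + 1 < 2 * k \<and> q1 + 3 * k = 3 * y + 2 \<and> q2 = 3 * y \<and> q3 = 3 * y + 4 \<or>
     y + 1 = 2 * k \<and> q1 = 1 \<and> q2 + 1 = 3 * k \<and> q3 + 3 = 6 * k"
    using sorted_positions_ladder_word[OF \<open>y < 2 * k\<close> \<open>2 \<le> k\<close>] .
  let ?I = "p1 < q1 \<and> q1 < p2 \<and> p2 < q2 \<and> q2 < p3 \<and> p3 < q3 \<or>
    q1 < p1 \<and> p1 < q2 \<and> q2 < p2 \<and> p2 < q3 \<and> q3 < p3"
  have "alternate x y (ladder_word k) \<longleftrightarrow> ?I"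
    using alternate_iff_interleaved[OF p(1-3) q(1-3)] \<open>x < y\<close> by simp
  also have "\<dots> \<longleftrightarrow> y = x + 1 \<or> y = x + k \<or> x = 0 \<and> y + 1 = 2 * k"
  proof
    assume ?I
    then show "y = x + 1 \<or> y = x + k \<or> x = 0 \<and> y + 1 = 2 * k"
      using p(4) q(4) assms by (elim disjE conjE; linarith)
  next
    assume "y = x + 1 \<or> y = x + k \<or> x = 0 \<and> y + 1 = 2 * k"
    then show ?I
      using p(4) q(4) assms
      by (elim disjE conjE, simp_all) presburger+
  qed
  also have "\<dots> \<longleftrightarrow> y - x \<in> {1, k, 2 * k - 1}" using assms by auto
  finally show ?thesis .
qed

lemma count_list_conv_positions: "count_list w x = card {i. i < length w \<and> w ! i = x}"
  by (simp add: count_list_eq_length_filter length_filter_conv_card eq_commute)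

lemma count_list_ladder_word:
  assumes "x < 2 * k" "2 \<le> k"
  shows "count_list (ladder_word k) x = 3"
proof -
  obtain p1 p2 p3 where
    "{i. i < length (ladder_word k) \<and> ladder_word k ! i = x} = {p1, p2, p3}" "p1 < p2" "p2 < p3"
    using sorted_positions_ladder_word[OF assms] .
  then show ?thesis by (simp add: count_list_conv_positions)
qed

lemma set_ladder_word:
  assumes "2 \<le> k"
  shows "set (ladder_word k) = {..<2 * k}"
proof
  show "set (ladder_word k) \<subseteq> {..<2 * k}"
    using assms by (auto simp: ladder_word_def ladder_letter_def Let_def)
  show "{..<2 * k} \<subseteq> set (ladder_word k)"
    using count_list_ladder_word[OF _ assms] by (metis count_notin lessThan_iff subsetI zero_neq_numeral)
qed

section \<open>Transport to the circulant graph\<close>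

text \<open>
  Modulo \<open>2 * n\<close> one has \<open>a = a * 1\<close> and, \<open>a\<close> being odd, \<open>n = a * n\<close>.  Cancelling the unit \<open>a\<close>
  therefore turns the differences \<open>a\<close> and \<open>n\<close> of residues into the differences \<open>1\<close> and \<open>n\<close>.
\<close>

lemma circulant_mult_adjacent_iff:
  fixes n a x y :: int
  assumes "coprime a (2 * n)" "0 < n" "0 < a" "a < n" "0 \<le> x" "x < y" "y < 2 * n"
  shows "(a * x mod (2 * n), a * y mod (2 * n)) \<in> parcs (circulant (2 * n) {a, n}) \<longleftrightarrow>
    y - x \<in> {1, n, 2 * n - 1}"
proof -
  have "odd a" using assms(1) by auto
  have an: "[a * n = n] (mod (2 * n))"
  proof -
    obtain b where "a = 2 * b + 1" using \<open>odd a\<close> by (rule oddE)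
    then have "a * n - n = (2 * n) * b" by (simp add: algebra_simps)
    then show ?thesis by (simp add: cong_iff_dvd_diff)
  qed
  have step: "(a * u mod (2 * n) - a * v mod (2 * n)) mod (2 * n) \<in> {a, n} \<longleftrightarrow>
      [u - v = 1] (mod (2 * n)) \<or> [u - v = n] (mod (2 * n))" for u v
  proof -
    have eq: "(a * u mod (2 * n) - a * v mod (2 * n)) mod (2 * n) = (a * (u - v)) mod (2 * n)"
      by (simp add: mod_diff_eq right_diff_distrib)
    have "(a * (u - v)) mod (2 * n) = a \<longleftrightarrow> [a * (u - v) = a * 1] (mod (2 * n))"
      using assms by (simp add: cong_def)
    also have "\<dots> \<longleftrightarrow> [u - v = 1] (mod (2 * n))"
      using assms(1) by (rule cong_mult_lcancel)
    finally have 1: "(a * (u - v)) mod (2 * n) = a \<longleftrightarrow> [u - v = 1] (mod (2 * n))" .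
    have "(a * (u - v)) mod (2 * n) = n \<longleftrightarrow> [a * (u - v) = n] (mod (2 * n))"
      using assms by (simp add: cong_def)
    also have "\<dots> \<longleftrightarrow> [a * (u - v) = a * n] (mod (2 * n))"
      using an by (meson cong_sym cong_trans)
    also have "\<dots> \<longleftrightarrow> [u - v = n] (mod (2 * n))"
      using assms(1) by (rule cong_mult_lcancel)
    finally have 2: "(a * (u - v)) mod (2 * n) = n \<longleftrightarrow> [u - v = n] (mod (2 * n))" .
    show ?thesis unfolding eq using 1 2 by simp
  qed
  have pos: "(y - x) mod (2 * n) = y - x" using assms by simp
  have "(x - y) mod (2 * n) = (x - y + 2 * n) mod (2 * n)" by simp
  also have "\<dots> = x - y + 2 * n" using assms by (intro mod_pos_pos_trivial) auto
  finally have neg: "(x - y) mod (2 * n) = x - y + 2 * n" .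
  have "\<not> [x = y] (mod (2 * n))" using assms by (simp add: cong_def)
  then have "a * x mod (2 * n) \<noteq> a * y mod (2 * n)"
    using cong_mult_lcancel[OF assms(1), of x y] by (simp add: cong_def)
  then have "(a * x mod (2 * n), a * y mod (2 * n)) \<in> parcs (circulant (2 * n) {a, n}) \<longleftrightarrow>
      ([x - y = 1] (mod (2 * n)) \<or> [x - y = n] (mod (2 * n))) \<or>
      ([y - x = 1] (mod (2 * n)) \<or> [y - x = n] (mod (2 * n)))"
    unfolding step[symmetric] using \<open>0 < n\<close> by (simp add: circulant_def)
  also have "\<dots> \<longleftrightarrow> y - x \<in> {1, n, 2 * n - 1}"
    using assms unfolding cong_def pos neg by auto
  finally show ?thesis .
qed

lemma bij_betw_mult_mod:
  fixes m a :: int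
  assumes "coprime a m" "0 < m"
  shows "bij_betw (\<lambda>x. a * int x mod m) {..<nat m} {0..<m}"
proof -
  have inj: "inj_on (\<lambda>x. a * int x mod m) {..<nat m}"
  proof
    fix x y assume "x \<in> {..<nat m}" "y \<in> {..<nat m}" and "a * int x mod m = a * int y mod m"
    moreover from this have "[int x = int y] (mod m)"
      using cong_mult_lcancel[OF assms(1)] by (simp add: cong_def)
    ultimately show "x = y" by (auto simp: cong_def)
  qed
  moreover have "(\<lambda>x. a * int x mod m) ` {..<nat m} = {0..<m}"
    using assms by (intro card_subset_eq) (auto simp: card_image[OF inj])
  ultimately show ?thesis by (simp add: bij_betw_def)
qed

lemma alternate_map:
  assumes "inj_on h (set w \<union> {x, y})"
  shows "alternate (h x) (h y) (map h w) \<longleftrightarrow> alternate x y w"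
proof -
  have map_alt: "map h (alternating_word u v m) = alternating_word (h u) (h v) m" for u v m
    by (induction m arbitrary: u v) auto
  have set_alt: "set (alternating_word u v m) \<subseteq> {u, v}" for u v :: 'a and m
    by (induction m arbitrary: u v) auto
  have filt: "filter (\<lambda>z. z = h x \<or> z = h y) (map h w) = map h (filter (\<lambda>z. z = x \<or> z = y) w)"
    unfolding filter_map comp_def
    using assms by (intro arg_cong[where f = "map h"] filter_cong) (auto simp: inj_on_def)
  have inj: "map h (filter (\<lambda>z. z = x \<or> z = y) w) = map h (alternating_word u v m) \<longleftrightarrow>
      filter (\<lambda>z. z = x \<or> z = y) w = alternating_word u v m" if "{u, v} = {x, y}" for u v m
    using assms set_alt[of u v m] that
    by (intro inj_on_map_eq_map) (auto intro: inj_on_subset)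
  show ?thesis
    unfolding alternate_def filt map_alt[symmetric] using inj[of x y] inj[of y x] by auto
qed

lemma represents_map:
  assumes bij: "bij_betw h (set w) (verts G)"
    and adj: "\<And>x y. x \<in> set w \<Longrightarrow> y \<in> set w \<Longrightarrow> x \<noteq> y \<Longrightarrow> h x \<rightarrow>\<^bsub>G\<^esub> h y \<longleftrightarrow> alternate x y w"
  shows "represents (map h w) G"
proof -
  have h: "verts G = h ` set w" "inj_on h (set w)" using bij by (auto simp: bij_betw_def)
  have "alternate (h x) (h y) (map h w) \<longleftrightarrow> alternate x y w" if "x \<in> set w" "y \<in> set w" for x y
    using that h(2) by (intro alternate_map) (simp add: insert_absorb)
  then show ?thesis
    unfolding represents_def h(1) using adj by auto
qed

lemma count_list_map:
  assumes "inj_on h (set w)" "x \<in> set w"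
  shows "count_list (map h w) (h x) = count_list w x"
proof -
  have "filter (\<lambda>z. h x = h z) w = filter ((=) x) w"
    using assms by (intro filter_cong) (auto simp: inj_on_def)
  then show ?thesis by (simp add: count_list_eq_length_filter filter_map comp_def)
qed

text \<open>
  The vertex map is taken from \<open>H\<close> back to \<open>G\<close>, the direction in which a word over the vertices
  of the concrete graph \<open>H\<close> is renamed.
\<close>

lemma digraph_iso_inverse_map:
  assumes "digraph_iso G H"
  obtains f where "bij_betw f (verts H) (verts G)"
    "\<And>u v. u \<in> verts H \<Longrightarrow> v \<in> verts H \<Longrightarrow> f u \<rightarrow>\<^bsub>G\<^esub> f v \<longleftrightarrow> u \<rightarrow>\<^bsub>H\<^esub> v"
proof -
  obtain i where i: "pre_digraph.digraph_isomorphism G i" and H: "H = app_iso i G"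
    using assms by (auto simp: digraph_iso_def)
  then interpret wf_digraph G by (simp add: pre_digraph.digraph_isomorphism_def)
  let ?g = "iso_verts i" and ?f = "the_inv_into (verts G) (iso_verts i)"
  have inj: "inj_on ?g (verts G)" using i by (rule digraph_isomorphism_inj_on_verts)
  have V: "verts H = ?g ` verts G" by (simp add: H)
  have "?g u \<rightarrow>\<^bsub>H\<^esub> ?g v \<longleftrightarrow> u \<rightarrow>\<^bsub>G\<^esub> v" if "u \<in> verts G" "v \<in> verts G" for u v
  proof
    assume "?g u \<rightarrow>\<^bsub>H\<^esub> ?g v"
    then obtain u' v' where e: "u' \<rightarrow>\<^bsub>G\<^esub> v'" and eq: "?g u = ?g u'" "?g v = ?g v'"
      unfolding H arcs_ends_app_iso_eq[OF i] by auto
    have "u = u'" "v = v'"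
      using inj_onD[OF inj eq(1) that(1)] inj_onD[OF inj eq(2) that(2)] adj_in_verts[OF e] by auto
    with e show "u \<rightarrow>\<^bsub>G\<^esub> v" by simp
  next
    assume "u \<rightarrow>\<^bsub>G\<^esub> v"
    then show "?g u \<rightarrow>\<^bsub>H\<^esub> ?g v"
      unfolding H arcs_ends_app_iso_eq[OF i] by (rule rev_image_eqI) simp
  qed
  then have "?f u \<rightarrow>\<^bsub>G\<^esub> ?f v \<longleftrightarrow> u \<rightarrow>\<^bsub>H\<^esub> v" if "u \<in> verts H" "v \<in> verts H" for u v
    using that unfolding V by (auto simp: the_inv_into_f_f[OF inj])
  moreover have "bij_betw ?f (verts H) (verts G)"
    unfolding V using inj by (intro bij_betw_the_inv_into) (simp add: bij_betw_def)
  ultimately show ?thesis using that by blast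
qed

theorem theorem3p2:
  fixes n a :: int and G :: "('v, 'e) pre_digraph"
  assumes "0 < n" and "0 < a" and "a < n" and "gcd a (2 * n) = 1"
    and "graph G"
    and "digraph_iso G (with_proj (circulant (2 * n) {a, n}))"
  shows "word_representable G \<and> representation_number G \<le> 3"
proof -
  let ?C = "with_proj (circulant (2 * n) {a, n})"
  obtain f where f: "bij_betw f (verts ?C) (verts G)"
    and fadj: "\<And>u v. u \<in> verts ?C \<Longrightarrow> v \<in> verts ?C \<Longrightarrow> f u \<rightarrow>\<^bsub>G\<^esub> f v \<longleftrightarrow> u \<rightarrow>\<^bsub>?C\<^esub> v"
    using digraph_iso_inverse_map[OF assms(6)] by blast
  have V: "verts ?C = {0..<2 * n}" by (simp add: circulant_def)
  have cop: "coprime a (2 * n)" using assms(4) by (simp add: coprime_iff_gcd_eq_1)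
  define k where "k = nat n"
  have k: "2 \<le> k" "n = int k" "nat (2 * n) = 2 * k" using assms(1-3) by (auto simp: k_def)
  define g where "g x = a * int x mod (2 * n)" for x
  define h where "h x = f (g x)" for x
  define w where "w = ladder_word k"
  have setw: "set w = {..<2 * k}" unfolding w_def using k(1) by (rule set_ladder_word)
  have g: "bij_betw g {..<2 * k} {0..<2 * n}"
    using bij_betw_mult_mod[OF cop] assms(1) by (simp add: g_def[abs_def] k(3))
  have h: "bij_betw h (set w) (verts G)"
    using bij_betw_trans[OF g f[unfolded V]] by (simp add: h_def[abs_def] comp_def setw)
  have adj_less: "(h x \<rightarrow>\<^bsub>G\<^esub> h y \<longleftrightarrow> alternate x y w) \<and> (h y \<rightarrow>\<^bsub>G\<^esub> h x \<longleftrightarrow> alternate y x w)"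
    if "x < y" "y < 2 * k" for x y
  proof -
    have gV: "g x \<in> verts ?C" "g y \<in> verts ?C"
      unfolding V using that g by (auto simp: bij_betw_def)
    have "g x \<rightarrow>\<^bsub>?C\<^esub> g y \<longleftrightarrow> int y - int x \<in> {1, n, 2 * n - 1}"
      using circulant_mult_adjacent_iff[OF cop assms(1-3), of "int x" "int y"] that k
      by (simp add: g_def)
    also have "\<dots> \<longleftrightarrow> y - x \<in> {1, k, 2 * k - 1}" using that k by auto
    also have "\<dots> \<longleftrightarrow> alternate x y w"
      unfolding w_def using alternate_ladder_word[OF that k(1)] by simp
    finally have "g x \<rightarrow>\<^bsub>?C\<^esub> g y \<longleftrightarrow> alternate x y w" .
    moreover have "g y \<rightarrow>\<^bsub>?C\<^esub> g x \<longleftrightarrow> g x \<rightarrow>\<^bsub>?C\<^esub> g y"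
      by (auto simp: circulant_def)
    ultimately show ?thesis
      using fadj[OF gV] fadj[OF gV(2,1)] alternate_commute[of x y w] by (simp add: h_def)
  qed
  have rep: "represents (map h w) G"
    using h
  proof (rule represents_map)
    fix x y assume "x \<in> set w" "y \<in> set w" "x \<noteq> y"
    then show "h x \<rightarrow>\<^bsub>G\<^esub> h y \<longleftrightarrow> alternate x y w"
      using adj_less[of x y] adj_less[of y x] by (cases "x < y") (auto simp: setw)
  qed
  have "uniform_word 3 (verts G) (map h w)"
    unfolding uniform_word_def
  proof
    fix v assume "v \<in> verts G"
    then obtain x where x: "x \<in> set w" "v = h x" using h by (auto simp: bij_betw_def)
    then show "count_list (map h w) v = 3"
      using count_list_map[of h w x] h count_list_ladder_word[OF _ k(1), of x] setw
      by (simp add: bij_betw_def w_def)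
  qed
  with rep have "r_word_representable 3 G" by (auto simp: r_word_representable_def)
  then have "representation_number G \<le> enat 3"
    unfolding representation_number_def by (intro INF_lower) simp
  with rep show ?thesis by (auto simp: word_representable_def numeral_eq_enat)
qed

end
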